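(* Let $d\ge1$ and let $(\mathbb Z^d,E,\mu,w)$ be the weighted nearest-neighbour lattice graph with vertex measure $\mu(x)=\sum_{y\sim x}w_{xy}$, satisfying $0<\mu_{\min}\le\mu_{\max}<\infty$ and $\inf_{x\sim y}w_{xy}>0$, with normalized Laplacian $\Delta$. Then for every $u\in C_c(\mathbb Z^d)$ one has the pointwise convergence $$\lim_{s\to0^+}(-\Delta)^su(x)=u(x),\qquad x\in\mathbb Z^d .$$
   Context: Weighted lattice graph: vertex set $\mathbb Z^d$, with $x\sim y$ iff $|x-y|_1=1$; symmetric weights $w_{xy}=w_{yx}>0$ if $x\sim y$ and $w_{xy}=0$ otherwise (in particular $w_{xx}=0$); $\mu(x)=\sum_{y\sim x}w_{xy}$; $\mu_{\min}=\inf_x\mu(x)$, $\mu_{\max}=\sup_x\mu(x)$. $C_c(\mathbb Z^d)$ is the space of finitely supported real functions. The normalized Laplacian is $\Delta u(x)=\frac1{\mu(x)}\sum_{y\sim x}w_{xy}(u(y)-u(x))$, a bounded self-adjoint operator on $\ell^2(\mathbb Z^d,\mu)$. The heat kernel $p(t,x,y)$, $t\ge0$, is defined by $e^{t\Delta}u(x)=\sum_{y}p(t,x,y)u(y)\mu(y)$, i.e. $p(t,x,y)=\mu(y)^{-1}(e^{t\Delta}\mathbf 1_{\{y\}})(x)$. For $0<s<1$ and bounded $u$ the fractional Laplacian is $$(-\Delta)^su(x)=\frac1{\mu(x)}\sum_{y\ne x}W_s(x,y)\bigl(u(x)-u(y)\bigr),\qquad W_s(x,y)=\frac{s}{\Gamma(1-s)}\mu(x)\mu(y)\int_0^\infty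 p(t,x,y)\,t^{-1-s}\,dt .$$ *)

theory Defs
  imports "HOL-Analysis.Analysis"
begin

definition lattice_adj :: "int ^ 'd \<Rightarrow> int ^ 'd \<Rightarrow> bool" where
  "lattice_adj x y \<longleftrightarrow> (\<Sum>i\<in>UNIV. \<bar>x $ i - y $ i\<bar>) = 1"

definition lattice_weight :: "(int ^ 'd \<Rightarrow> int ^ 'd \<Rightarrow> real) \<Rightarrow> bool" where
  "lattice_weight w \<longleftrightarrow>
     (\<forall>x y. w x y = w y x) \<and>
     (\<forall>x y. lattice_adj x y \<longrightarrow> 0 < w x y) \<and>
     (\<forall>x y. \<not> lattice_adj x y \<longrightarrow> w x y = 0)"

text \<open>The sums over neighbours below are genuine finite sums.\<close>

lemma finite_lattice_neighbours: "finite {y. lattice_adj x (y :: int ^ 'd)}"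
proof -
  have "{y. lattice_adj x y} \<subseteq> {y. \<forall>i. y $ i \<in> {x $ i - 1..x $ i + 1}}"
  proof (clarify)
    fix y i
    assume "lattice_adj x y"
    moreover have "\<bar>x $ i - y $ i\<bar> \<le> (\<Sum>i\<in>UNIV. \<bar>x $ i - y $ i\<bar>)"
      by (rule member_le_sum) auto
    ultimately show "y $ i \<in> {x $ i - 1..x $ i + 1}"
      by (auto simp: lattice_adj_def)
  qed
  moreover have "finite {y :: int ^ 'd. \<forall>i. y $ i \<in> {x $ i - 1..x $ i + 1}}"
  proof -
    have "finite (vec_nth ` {y :: int ^ 'd. \<forall>i. y $ i \<in> {x $ i - 1..x $ i + 1}})"
      by (rule finite_subset[OF _ finite_PiE[of UNIV "\<lambda>i. {x $ i - 1..x $ i + 1}"]])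
         (auto simp: PiE_def)
    then show ?thesis
      by (rule finite_imageD) (auto simp: inj_on_def vec_eq_iff)
  qed
  ultimately show ?thesis
    by (rule finite_subset)
qed

definition vertex_measure :: "(int ^ 'd \<Rightarrow> int ^ 'd \<Rightarrow> real) \<Rightarrow> int ^ 'd \<Rightarrow> real" where
  "vertex_measure w x = (\<Sum>y | lattice_adj x y. w x y)"

text \<open>Infima and suprema are taken in the extended reals, so that
  \<open>mu_max w < \<infinity>\<close> is a genuine boundedness condition.\<close>

definition mu_min :: "(int ^ 'd \<Rightarrow> int ^ 'd \<Rightarrow> real) \<Rightarrow> ereal" where
  "mu_min w = (INF x. ereal (vertex_measure w x))"

definition mu_max :: "(int ^ 'd \<Rightarrow> int ^ 'd \<Rightarrow> real) \<Rightarrow> ereal" where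
  "mu_max w = (SUP x. ereal (vertex_measure w x))"

definition w_min :: "(int ^ 'd \<Rightarrow> int ^ 'd \<Rightarrow> real) \<Rightarrow> ereal" where
  "w_min w = (INF (x, y) \<in> {(x, y). lattice_adj x y}. ereal (w x y))"

definition normalized_laplacian ::
    "(int ^ 'd \<Rightarrow> int ^ 'd \<Rightarrow> real) \<Rightarrow> (int ^ 'd \<Rightarrow> real) \<Rightarrow> int ^ 'd \<Rightarrow> real" where
  "normalized_laplacian w u x =
     (\<Sum>y | lattice_adj x y. w x y * (u y - u x)) / vertex_measure w x"

definition l2 :: "('a \<Rightarrow> real) \<Rightarrow> ('a \<Rightarrow> real) set" where
  "l2 m = {u. (\<lambda>x. (u x)\<^sup>2 * m x) summable_on UNIV}"

definition l2_norm :: "('a \<Rightarrow> real) \<Rightarrow> ('a \<Rightarrow> real) \<Rightarrow> real" where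
  "l2_norm m u = sqrt (\<Sum>\<^sub>\<infinity>x. (u x)\<^sup>2 * m x)"

text \<open>The exponential of an operator \<open>A\<close> that is bounded on \<open>l2 m\<close>, applied to a vector
  \<open>u\<close> of \<open>l2 m\<close>: the limit of the exponential series in the norm of \<open>l2 m\<close>. Vectors
  are plain functions because \<open>l2 m\<close> depends on \<open>m\<close> and so cannot be made a type; for
  \<open>m > 0\<close> the limit is unique as a function.\<close>

definition l2_exp ::
    "('a \<Rightarrow> real) \<Rightarrow> (('a \<Rightarrow> real) \<Rightarrow> 'a \<Rightarrow> real) \<Rightarrow> ('a \<Rightarrow> real) \<Rightarrow> 'a \<Rightarrow> real" where
  "l2_exp m A u = (THE v. v \<in> l2 m \<and>
     (\<lambda>n. l2_norm m (\<lambda>x. (\<Sum>k<n. (A ^^ k) u x / fact k) - v x)) \<longlonglongrightarrow> 0)"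

definition heat_semigroup ::
    "(int ^ 'd \<Rightarrow> int ^ 'd \<Rightarrow> real) \<Rightarrow> real \<Rightarrow> (int ^ 'd \<Rightarrow> real) \<Rightarrow> int ^ 'd \<Rightarrow> real" where
  "heat_semigroup w t =
     l2_exp (vertex_measure w) (\<lambda>u x. t * normalized_laplacian w u x)"

definition heat_kernel ::
    "(int ^ 'd \<Rightarrow> int ^ 'd \<Rightarrow> real) \<Rightarrow> real \<Rightarrow> int ^ 'd \<Rightarrow> int ^ 'd \<Rightarrow> real" where
  "heat_kernel w t x y = heat_semigroup w t (indicator {y}) x / vertex_measure w y"

text \<open>The integral diverges for \<open>x = y\<close> (and then has the value 0 by convention); this diagonal
  value is never used.\<close>

definition frac_weight ::
    "(int ^ 'd \<Rightarrow> int ^ 'd \<Rightarrow> real) \<Rightarrow> real \<Rightarrow> int ^ 'd \<Rightarrow> int ^ 'd \<Rightarrow> real" where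
  "frac_weight w s x y =
     s / Gamma (1 - s) * vertex_measure w x * vertex_measure w y *
     (LBINT t:{0<..}. heat_kernel w t x y * t powr (- 1 - s))"

definition frac_laplacian ::
    "(int ^ 'd \<Rightarrow> int ^ 'd \<Rightarrow> real) \<Rightarrow> real \<Rightarrow> (int ^ 'd \<Rightarrow> real) \<Rightarrow> int ^ 'd \<Rightarrow> real" where
  "frac_laplacian w s u x =
     (\<Sum>\<^sub>\<infinity>y\<in>- {x}. frac_weight w s x y * (u x - u y)) / vertex_measure w x"

end

theory Submission imports Defs begin

text \<open>Write \<open>P = I + \<Delta>\<close> for the averaging operator, i.e. the transition operator of the random walk
  that steps from \<open>x\<close> to \<open>y\<close> with probability \<open>w x y / \<mu> x\<close>. The binomial series of
  \<open>(I - P)\<^sup>s\<close> reads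
    \<open>(-\<Delta>)\<^sup>s = I - (\<Sum>k\<ge>1. a\<^sub>k(s) P\<^sup>k)\<close>, with \<open>a\<^sub>k(s) = (s/k) (1 - s/1) \<dots> (1 - s/(k-1))\<close>,
  where the \<open>a\<^sub>k(s)\<close> are nonnegative and add up to \<open>1\<close>; they are known as the Sibuya distribution.
  So \<open>(-\<Delta>)\<^sup>s u(x) = u(x) - E[(P\<^sup>N u)(x)]\<close> for a Sibuya distributed time \<open>N\<close>.
  Since \<open>a\<^sub>k(s) \<le> s\<close> for every \<open>k\<close>, the time \<open>N\<close> escapes to infinity as \<open>s\<close> tends to \<open>0\<close>, and the
  limit is \<open>u(x)\<close> as soon as \<open>(P\<^sup>k 1\<^sub>y)(x) \<longlonglongrightarrow> 0\<close> for all \<open>x\<close> and \<open>y\<close> as \<open>k\<close> grows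
  (lemmas \<open>sibuya_mean_tendsto_0\<close> and \<open>frac_laplacian_eq\<close>).

  The kernel decay (\<open>walk_tendsto_0\<close>) comes from energy dissipation. The energy
  \<open>\<parallel>P\<^sup>k 1\<^sub>y\<parallel>\<^sup>2\<close> in \<open>\<ell>\<^sup>2(\<mu>)\<close> decreases in \<open>k\<close>, so its decrements tend to \<open>0\<close>; a decrement is a
  sum of local variances, so \<open>P\<^sup>k 1\<^sub>y\<close> takes asymptotically equal values at points at distance two. A
  kernel that stays large at one vertex would then be large at arbitrarily many vertices of a ray,
  but its total mass is bounded by \<open>\<mu> y\<close>, while each vertex has measure at least \<open>m > 0\<close>.

  To obtain the series for \<open>(-\<Delta>)\<^sup>s\<close> from its definition by heat kernels, the semigroup is expanded as
  \<open>e\<^sup>t\<^sup>\<Delta> 1\<^sub>y = e\<^sup>-\<^sup>t (\<Sum>k. t\<^sup>k/k! P\<^sup>k 1\<^sub>y)\<close> (\<open>heat_semigroup_indicator\<close>) and integrated term by term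
  against \<open>t powr (-1 - s)\<close>; each term is a Gamma integral (\<open>frac_weight_eq_sibuya_mean\<close>).\<close>

lemma has_sum_sum:
  fixes f :: "'a \<Rightarrow> 'b \<Rightarrow> 'c :: topological_comm_monoid_add"
  assumes "\<And>i. i \<in> I \<Longrightarrow> (f i has_sum s i) A"
  shows "((\<lambda>x. \<Sum>i\<in>I. f i x) has_sum (\<Sum>i\<in>I. s i)) A"
  using assms by (induction I rule: infinite_finite_induct) (auto intro!: has_sum_add)

section \<open>The random walk of the weighted lattice\<close>

locale weighted_lattice =
  fixes w :: "int ^ 'd \<Rightarrow> int ^ 'd \<Rightarrow> real" and m :: real
  assumes weight: "lattice_weight w"
    and m_pos: "0 < m"
    and m_le: "m \<le> vertex_measure w x"
begin

abbreviation "\<mu> \<equiv> vertex_measure w"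

definition avg :: "(int ^ 'd \<Rightarrow> real) \<Rightarrow> int ^ 'd \<Rightarrow> real" where
  "avg f x = (\<Sum>y | lattice_adj x y. w x y * f y) / \<mu> x"

text \<open>As a function of \<open>x\<close>, \<open>walk k y\<close> is \<open>P\<^sup>k 1\<^sub>y\<close>: the value \<open>walk k y x\<close> is the probability that the
  walk started at \<open>x\<close>, the last argument, is at \<open>y\<close> after \<open>k\<close> steps.\<close>

definition walk :: "nat \<Rightarrow> int ^ 'd \<Rightarrow> int ^ 'd \<Rightarrow> real" where
  "walk k y = (avg ^^ k) (indicator {y})"

lemma mu_pos: "0 < \<mu> x"
  using m_pos m_le[of x] by linarith

lemma w_commute: "w x y = w y x"
  and w_pos: "lattice_adj x y \<Longrightarrow> 0 < w x y"
  and w_zero: "\<not> lattice_adj x y \<Longrightarrow> w x y = 0"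
  using weight by (auto simp: lattice_weight_def)

lemma w_nonneg: "0 \<le> w x y"
  using w_pos[of x y] w_zero[of x y] by (cases "lattice_adj x y") auto

lemma mu_avg: "\<mu> x * avg f x = (\<Sum>y | lattice_adj x y. w x y * f y)"
  using mu_pos[of x] by (simp add: avg_def)

lemma mu_avg_eq_sum_support:
  assumes "finite S" "\<And>y. y \<notin> S \<Longrightarrow> f y = 0"
  shows "\<mu> x * avg f x = (\<Sum>y\<in>S. w x y * f y)"
proof -
  have "(\<Sum>y | lattice_adj x y. w x y * f y) = (\<Sum>y\<in>S. w x y * f y)"
    by (rule sum.mono_neutral_cong) (use assms finite_lattice_neighbours w_zero in auto)
  then show ?thesis by (simp add: mu_avg)
qed

lemma sum_weight_le_mu:
  assumes "finite B"
  shows "(\<Sum>x\<in>B. w x y) \<le> \<mu> y"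
proof -
  have "(\<Sum>x\<in>B. w x y) = (\<Sum>x\<in>B \<inter> {x. lattice_adj y x}. w y x)"
    by (rule sum.mono_neutral_cong_right) (use assms w_zero w_commute[of _ y] in auto)
  also have "\<dots> \<le> (\<Sum>x | lattice_adj y x. w y x)"
    by (rule sum_mono2) (auto intro: w_nonneg finite_lattice_neighbours)
  finally show ?thesis by (simp add: vertex_measure_def)
qed

text \<open>Averaging does not increase mass, because \<open>\<mu>\<close> is a reversible measure of the walk: \<open>\<mu> x\<close> times
  the transition probability from \<open>x\<close> to \<open>y\<close> is the symmetric weight \<open>w x y\<close>. Restricting the left side
  to a finite set \<open>B\<close> avoids infinite sums; only an inequality is lost.\<close>

lemma avg_mass_le:
  assumes "finite S" "\<And>y. y \<notin> S \<Longrightarrow> f y = 0" "\<And>y. 0 \<le> f y" "finite B"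
  shows "(\<Sum>x\<in>B. \<mu> x * avg f x) \<le> (\<Sum>y\<in>S. \<mu> y * f y)"
proof -
  have "(\<Sum>x\<in>B. \<mu> x * avg f x) = (\<Sum>x\<in>B. \<Sum>y\<in>S. w x y * f y)"
    using mu_avg_eq_sum_support[OF assms(1,2)] by simp
  also have "\<dots> = (\<Sum>y\<in>S. (\<Sum>x\<in>B. w x y) * f y)"
    by (subst sum.swap) (simp add: sum_distrib_right)
  also have "\<dots> \<le> (\<Sum>y\<in>S. \<mu> y * f y)"
    using assms by (intro sum_mono mult_right_mono sum_weight_le_mu) auto
  finally show ?thesis .
qed

lemma avg_nonneg: "(\<And>y. 0 \<le> f y) \<Longrightarrow> 0 \<le> avg f x"
  unfolding avg_def using mu_pos[of x]
  by (intro divide_nonneg_pos sum_nonneg mult_nonneg_nonneg) (auto intro: w_nonneg)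

lemma avg_le:
  assumes "\<And>y. f y \<le> c"
  shows "avg f x \<le> c"
proof -
  have "(\<Sum>y | lattice_adj x y. w x y * f y) \<le> (\<Sum>y | lattice_adj x y. w x y * c)"
    using assms by (intro sum_mono mult_left_mono) (auto intro: w_nonneg)
  also have "\<dots> = \<mu> x * c"
    by (simp add: vertex_measure_def sum_distrib_right)
  finally show ?thesis
    using mu_pos[of x] by (simp add: avg_def field_simps)
qed

text \<open>The left side is \<open>\<mu> x\<close> times the variance of \<open>f\<close> at the position after one step from \<open>x\<close>. Summed over \<open>x\<close>, the
  right side becomes the energy that \<open>f\<close> loses by averaging.\<close>

lemma avg_variance:
  "(\<Sum>y | lattice_adj x y. w x y * (f y - avg f x)\<^sup>2)
     = \<mu> x * avg (\<lambda>y. (f y)\<^sup>2) x - \<mu> x * (avg f x)\<^sup>2"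
proof -
  have "(\<Sum>y | lattice_adj x y. w x y * (f y - avg f x)\<^sup>2)
      = (\<Sum>y | lattice_adj x y. w x y * (f y)\<^sup>2 - 2 * avg f x * (w x y * f y) + w x y * (avg f x)\<^sup>2)"
    by (intro sum.cong) (auto simp: power2_eq_square algebra_simps)
  also have "\<dots> = (\<Sum>y | lattice_adj x y. w x y * (f y)\<^sup>2)
      - 2 * avg f x * (\<Sum>y | lattice_adj x y. w x y * f y)
      + (\<Sum>y | lattice_adj x y. w x y) * (avg f x)\<^sup>2"
    by (simp add: sum.distrib sum_subtractf sum_distrib_left sum_distrib_right)
  also have "\<dots> = \<mu> x * avg (\<lambda>y. (f y)\<^sup>2) x - \<mu> x * (avg f x)\<^sup>2"
    unfolding mu_avg[symmetric] vertex_measure_def[symmetric]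
    by (simp add: power2_eq_square algebra_simps)
  finally show ?thesis .
qed

lemma finite_support_avg:
  assumes "finite {y. f y \<noteq> 0}"
  shows "finite {x. avg f x \<noteq> 0}"
proof -
  have "{x. avg f x \<noteq> 0} \<subseteq> (\<Union>y\<in>{y. f y \<noteq> 0}. {x. lattice_adj y x})"
  proof
    fix x assume "x \<in> {x. avg f x \<noteq> 0}"
    then have "(\<Sum>y | lattice_adj x y. w x y * f y) \<noteq> 0"
      by (auto simp: avg_def)
    then obtain y where y: "y \<in> {y. lattice_adj x y}" "w x y * f y \<noteq> 0"
      by (rule sum.not_neutral_contains_not_neutral)
    have "w y x \<noteq> 0"
      using y(2) w_commute[of y x] by auto
    then show "x \<in> (\<Union>y\<in>{y. f y \<noteq> 0}. {x. lattice_adj y x})"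
      using y(2) w_zero[of y x] by auto
  qed
  then show ?thesis
    by (rule finite_subset) (use assms finite_lattice_neighbours in auto)
qed

lemma walk_0: "walk 0 y = indicator {y}"
  and walk_Suc: "walk (Suc k) y = avg (walk k y)"
  by (simp_all add: walk_def)

lemma walk_nonneg: "0 \<le> walk k y x"
  by (induction k arbitrary: x) (simp_all add: walk_0 walk_Suc avg_nonneg)

lemma walk_le_1: "walk k y x \<le> 1"
  by (induction k arbitrary: x) (simp_all add: walk_0 walk_Suc avg_le indicator_def)

lemma finite_support_walk: "finite {x. walk k y x \<noteq> 0}"
  by (induction k) (simp_all add: walk_0 walk_Suc finite_support_avg indicator_eq_0_iff)

lemma walk_mass_le:
  assumes "finite B"
  shows "(\<Sum>x\<in>B. \<mu> x * walk k y x) \<le> \<mu> y"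
  using assms
proof (induction k arbitrary: B)
  case 0
  have "(\<Sum>x\<in>B. \<mu> x * walk 0 y x) = (\<Sum>x\<in>B. if x = y then \<mu> x else 0)"
    by (intro sum.cong) (auto simp: walk_0)
  then show ?case
    using 0 mu_pos[of y] by simp
next
  case (Suc k)
  have "(\<Sum>x\<in>B. \<mu> x * walk (Suc k) y x) \<le> (\<Sum>x | walk k y x \<noteq> 0. \<mu> x * walk k y x)"
    unfolding walk_Suc using Suc.prems
    by (intro avg_mass_le) (auto intro: finite_support_walk walk_nonneg)
  also have "\<dots> \<le> \<mu> y"
    by (rule Suc.IH[OF finite_support_walk])
  finally show ?case .
qed

section \<open>Decay of the transition probabilities\<close>

text \<open>The squared norm of \<open>\<ell>\<^sup>2(\<mu>)\<close>, as a sum over the support because only finitely supported functions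
  occur.\<close>

definition energy :: "(int ^ 'd \<Rightarrow> real) \<Rightarrow> real" where
  "energy f = (\<Sum>x | f x \<noteq> 0. \<mu> x * (f x)\<^sup>2)"

lemma energy_nonneg: "0 \<le> energy f"
  unfolding energy_def by (intro sum_nonneg mult_nonneg_nonneg) (auto simp: mu_pos less_imp_le)

text \<open>Total energy lost is the sum over all vertices of the local variances of \<open>avg_variance\<close>; it
  dominates each single summand of each single variance.\<close>

lemma energy_avg_drop:
  assumes "finite {y. f y \<noteq> 0}" "lattice_adj x y"
  shows "w x y * (f y - avg f x)\<^sup>2 \<le> energy f - energy (avg f)"
proof -
  \<comment> \<open>A finite set that supports \<open>avg f\<close> and contains \<open>x\<close>. Local variances are nonnegative, so
    those outside it can be dropped.\<close>
  let ?B = "insert x {z. avg f z \<noteq> 0}"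
  let ?v = "\<lambda>z. \<mu> z * avg (\<lambda>y. (f y)\<^sup>2) z - \<mu> z * (avg f z)\<^sup>2"
  have B: "finite ?B" using finite_support_avg[OF assms(1)] by simp
  have v: "0 \<le> ?v z" for z
    unfolding avg_variance[symmetric] by (intro sum_nonneg mult_nonneg_nonneg) (auto intro: w_nonneg)
  have "w x y * (f y - avg f x)\<^sup>2 \<le> (\<Sum>y | lattice_adj x y. w x y * (f y - avg f x)\<^sup>2)"
    by (rule member_le_sum)
       (use assms(2) in \<open>auto intro!: mult_nonneg_nonneg w_nonneg finite_lattice_neighbours\<close>)
  also have "\<dots> = ?v x" by (rule avg_variance)
  also have "\<dots> \<le> (\<Sum>z\<in>?B. ?v z)"
    by (rule member_le_sum) (use B v in auto)
  also have "\<dots> = (\<Sum>z\<in>?B. \<mu> z * avg (\<lambda>y. (f y)\<^sup>2) z) - (\<Sum>z\<in>?B. \<mu> z * (avg f z)\<^sup>2)"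
    by (rule sum_subtractf)
  also have "(\<Sum>z\<in>?B. \<mu> z * (avg f z)\<^sup>2) = energy (avg f)"
    unfolding energy_def by (rule sum.mono_neutral_right) (use B in auto)
  also have "(\<Sum>z\<in>?B. \<mu> z * avg (\<lambda>y. (f y)\<^sup>2) z) \<le> energy f"
    unfolding energy_def by (rule avg_mass_le[OF assms(1) _ _ B]) auto
  finally show ?thesis by simp
qed

text \<open>The energies form a decreasing nonnegative sequence, so the energy drops tend to \<open>0\<close>, and by
  \<open>energy_avg_drop\<close> they control the difference.\<close>

lemma walk_step_diff_tendsto_0:
  assumes "lattice_adj x z"
  shows "(\<lambda>k. walk k y z - walk (Suc k) y x) \<longlonglongrightarrow> 0"
proof -
  let ?e = "\<lambda>k. energy (walk k y)"
  have drop: "w x z * (walk k y z - walk (Suc k) y x)\<^sup>2 \<le> ?e k - ?e (Suc k)" for k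
    unfolding walk_Suc by (rule energy_avg_drop[OF finite_support_walk assms])
  have "decseq ?e"
  proof (rule decseq_SucI)
    fix k
    have "0 \<le> w x z * (walk k y z - walk (Suc k) y x)\<^sup>2"
      by (intro mult_nonneg_nonneg w_nonneg) auto
    then show "?e (Suc k) \<le> ?e k" using drop[of k] by linarith
  qed
  then obtain L where L: "?e \<longlonglongrightarrow> L"
    using decseq_convergent[of ?e 0] energy_nonneg by metis
  have "(\<lambda>k. (?e k - ?e (Suc k)) / w x z) \<longlonglongrightarrow> (L - L) / w x z"
    using w_pos[OF assms] by (intro tendsto_intros L LIMSEQ_Suc[OF L]) auto
  then have lim: "(\<lambda>k. (?e k - ?e (Suc k)) / w x z) \<longlonglongrightarrow> 0" by simp
  have "(\<lambda>k. (walk k y z - walk (Suc k) y x)\<^sup>2) \<longlonglongrightarrow> 0"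
    by (rule tendsto_sandwich[OF _ _ tendsto_const lim])
       (use drop w_pos[OF assms] in \<open>auto simp: field_simps\<close>)
  then show ?thesis
    by (simp add: power_tendsto_0_iff)
qed

text \<open>Points at distance two share a neighbour \<open>b\<close>, and both values at time \<open>k\<close> are asymptotically equal
  to the value at \<open>b\<close> at time \<open>k + 1\<close>. At a fixed time this compares only
  points of the same parity class, whence the even displacement; on the other class the kernel vanishes.\<close>

lemma walk_ray_diff_tendsto_0:
  "(\<lambda>k. walk k y (x + axis i (2 * int n)) - walk k y x) \<longlonglongrightarrow> 0"
proof (induction n)
  case 0
  have "axis i 0 = (0 :: int ^ 'd)" by (simp add: vec_eq_iff axis_def)
  then show ?case by (simp del: axis_eq_0_iff)
next
  case (Suc n)
  let ?a = "x + axis i (2 * int n)" and ?b = "x + axis i (2 * int n + 1)"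
    and ?c = "x + axis i (2 * int (Suc n))"
  have "(\<Sum>j\<in>UNIV. \<bar>?b $ j - ?a $ j\<bar>) = (\<Sum>j\<in>UNIV. if j = i then 1 else 0)"
    by (intro sum.cong) (auto simp: axis_def)
  then have ba: "lattice_adj ?b ?a" by (simp add: lattice_adj_def)
  have "(\<Sum>j\<in>UNIV. \<bar>?b $ j - ?c $ j\<bar>) = (\<Sum>j\<in>UNIV. if j = i then 1 else 0)"
    by (intro sum.cong) (auto simp: axis_def)
  then have bc: "lattice_adj ?b ?c" by (simp add: lattice_adj_def)
  have "(\<lambda>k. (walk k y ?c - walk (Suc k) y ?b) - (walk k y ?a - walk (Suc k) y ?b)
          + (walk k y ?a - walk k y x)) \<longlonglongrightarrow> 0 - 0 + 0"
    by (intro tendsto_intros walk_step_diff_tendsto_0 ba bc Suc)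
  then show ?case by simp
qed

text \<open>If the kernel were at least \<open>r\<close> at \<open>x\<close> for a late time, it would be at least \<open>r/2\<close> at \<open>N\<close> points of a ray
  from \<open>x\<close>. For large \<open>N\<close> this contradicts the bound \<open>\<mu> y\<close> on the total mass.\<close>

lemma walk_tendsto_0: "(\<lambda>k. walk k y x) \<longlonglongrightarrow> 0"
proof (rule LIMSEQ_I)
  fix r :: real assume r: "0 < r"
  \<comment> \<open>The ray runs in an arbitrary coordinate direction.\<close>
  define i :: 'd where "i = undefined"
  define p where "p = (\<lambda>n. x + axis i (2 * int n))"
  obtain N where N: "\<mu> y < real N * (m * r / 2)"
    using reals_Archimedean3[of "m * r / 2"] m_pos r by auto
  have "inj p"
    by (rule injI) (auto simp: p_def axis_def vec_eq_iff split: if_splits)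
  have "(\<lambda>k. \<Sum>n<N. \<bar>walk k y (p n) - walk k y x\<bar>) \<longlonglongrightarrow> (\<Sum>n<N. 0)"
    unfolding p_def by (intro tendsto_sum tendsto_rabs_zero walk_ray_diff_tendsto_0)
  then obtain k0 where k0: "\<And>k. k \<ge> k0 \<Longrightarrow> (\<Sum>n<N. \<bar>walk k y (p n) - walk k y x\<bar>) < r / 2"
    using LIMSEQ_D[of _ 0 "r / 2"] r by (fastforce simp: sum_nonneg)
  show "\<exists>k0. \<forall>k\<ge>k0. norm (walk k y x - 0) < r"
  proof (intro exI allI impI)
    fix k assume k: "k0 \<le> k"
    show "norm (walk k y x - 0) < r"
    proof (rule ccontr)
      assume "\<not> norm (walk k y x - 0) < r"
      then have big: "r \<le> walk k y x" using walk_nonneg[of k y x] by simp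
      have half: "r / 2 \<le> walk k y (p n)" if "n < N" for n
      proof -
        have "\<bar>walk k y (p n) - walk k y x\<bar> \<le> (\<Sum>n<N. \<bar>walk k y (p n) - walk k y x\<bar>)"
          by (rule member_le_sum) (use that in auto)
        then show ?thesis using k0[OF k] big by linarith
      qed
      have "real N * (m * r / 2) = (\<Sum>n<N. m * (r / 2))" by simp
      also have "\<dots> \<le> (\<Sum>n<N. \<mu> (p n) * walk k y (p n))"
        using half r m_le mu_pos by (intro sum_mono mult_mono) (auto simp: less_imp_le)
      also have "\<dots> = (\<Sum>x\<in>p ` {..<N}. \<mu> x * walk k y x)"
        using \<open>inj p\<close> by (subst sum.reindex) (auto intro: inj_on_subset)
      also have "\<dots> \<le> \<mu> y" by (rule walk_mass_le) auto
      finally show False using N by linarith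
    qed
  qed
qed

lemma walk_has_sum_1: "((\<lambda>y. walk k y x) has_sum 1) UNIV"
proof (induction k arbitrary: x)
  case 0
  have "((\<lambda>y. walk 0 y x) has_sum 1) UNIV"
    by (rule has_sum_finite_neutralI[of "{x}"]) (auto simp: walk_0)
  then show ?case .
next
  case (Suc k)
  have "((\<lambda>y. \<Sum>z | lattice_adj x z. w x z * walk k y z)
      has_sum (\<Sum>z | lattice_adj x z. w x z * 1)) UNIV"
    by (intro has_sum_sum has_sum_cmult_right[OF Suc])
  then have "((\<lambda>y. inverse (\<mu> x) * (\<Sum>z | lattice_adj x z. w x z * walk k y z))
      has_sum (inverse (\<mu> x) * (\<Sum>z | lattice_adj x z. w x z * 1))) UNIV"
    by (rule has_sum_cmult_right)
  then show ?case
    using mu_pos[of x] by (simp add: walk_Suc avg_def vertex_measure_def field_simps)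
qed

end

section \<open>The Sibuya distribution\<close>

text \<open>\<open>sibuya_tail s n\<close> is the probability that a Sibuya distributed time exceeds \<open>n\<close>, when the time
  \<open>j\<close> is selected with conditional probability \<open>s / j\<close> once the earlier ones were rejected.\<close>

definition sibuya_tail :: "real \<Rightarrow> nat \<Rightarrow> real" where
  "sibuya_tail s n = (\<Prod>j=1..n. 1 - s / real j)"

text \<open>\<open>sibuya s k\<close> is \<open>(-1)\<^sup>k\<^sup>+\<^sup>1\<close> times the generalised binomial coefficient of \<open>s\<close> over \<open>k\<close>,
  for \<open>k \<ge> 1\<close>. At \<open>k = 0\<close> division by zero gives the value \<open>0\<close>, so that series may
  start at \<open>0\<close>.\<close>

definition sibuya :: "real \<Rightarrow> nat \<Rightarrow> real" where
  "sibuya s k = s / real k * sibuya_tail s (k - 1)"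

lemma sibuya_0: "sibuya s 0 = 0"
  by (simp add: sibuya_def)

lemma sibuya_tail_bounds:
  assumes "0 < s" "s < 1"
  shows "0 \<le> sibuya_tail s n" "sibuya_tail s n \<le> 1"
proof -
  have "0 \<le> 1 - s / real j \<and> 1 - s / real j \<le> 1" if "j \<in> {1..n}" for j
    using that assms by (auto simp: field_simps)
  then show "0 \<le> sibuya_tail s n" "sibuya_tail s n \<le> 1"
    unfolding sibuya_tail_def by (auto intro!: prod_nonneg prod_le_1)
qed

lemma sibuya_nonneg: "0 < s \<Longrightarrow> s < 1 \<Longrightarrow> 0 \<le> sibuya s k"
  by (simp add: sibuya_def sibuya_tail_bounds)

lemma sibuya_le:
  assumes "0 < s" "s < 1"
  shows "sibuya s k \<le> s"
proof -
  have "s / real k \<le> s"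
    using assms by (cases k) (auto simp: field_simps)
  moreover have "sibuya s k \<le> s / real k * 1"
    unfolding sibuya_def using assms by (intro mult_left_mono sibuya_tail_bounds) auto
  ultimately show ?thesis by simp
qed

lemma sibuya_Suc: "sibuya s (Suc k) = sibuya_tail s k - sibuya_tail s (Suc k)"
proof -
  have "sibuya_tail s (Suc k) = sibuya_tail s k * (1 - s / real (Suc k))"
    by (simp add: sibuya_tail_def)
  then show ?thesis
    by (simp add: sibuya_def algebra_simps)
qed

text \<open>From \<open>1 - s/j \<le> exp (-s/j)\<close> the tail is at most \<open>exp (-s H\<^sub>n)\<close>, and the harmonic numbers \<open>H\<^sub>n\<close>
  diverge.\<close>

lemma sibuya_tail_tendsto_0:
  assumes "0 < s" "s < 1"
  shows "sibuya_tail s \<longlonglongrightarrow> 0"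
proof (rule tendsto_sandwich[OF _ _ tendsto_const])
  show "\<forall>\<^sub>F n in sequentially. 0 \<le> sibuya_tail s n"
    using assms by (simp add: sibuya_tail_bounds)
  have "sibuya_tail s n \<le> exp (- s * harm n)" for n
  proof -
    have "sibuya_tail s n \<le> (\<Prod>j=1..n. exp (- s / real j))"
      unfolding sibuya_tail_def
    proof (rule prod_mono)
      fix j assume "j \<in> {1..n}"
      then show "0 \<le> 1 - s / real j \<and> 1 - s / real j \<le> exp (- s / real j)"
        using assms exp_ge_add_one_self[of "- s / real j"] by (auto simp: field_simps)
    qed
    also have "\<dots> = exp (- s * harm n)"
      by (simp add: exp_sum[symmetric] harm_def sum_distrib_left divide_inverse)
    finally show ?thesis .
  qed
  then show "\<forall>\<^sub>F n in sequentially. sibuya_tail s n \<le> exp (- s * harm n)"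
    by simp
  have "filterlim (\<lambda>n. s * harm n :: real) at_top sequentially"
    by (rule filterlim_tendsto_pos_mult_at_top[OF tendsto_const \<open>0 < s\<close> harm_at_top])
  then have "filterlim (\<lambda>n. - s * harm n :: real) at_bot sequentially"
    by (simp add: filterlim_uminus_at_bot)
  then show "(\<lambda>n. exp (- s * harm n)) \<longlonglongrightarrow> 0"
    by (rule filterlim_compose[OF exp_at_bot])
qed

lemma sibuya_sums_1:
  assumes "0 < s" "s < 1"
  shows "sibuya s sums 1"
proof -
  have "(\<lambda>k. sibuya s (Suc k)) sums (sibuya_tail s 0 - 0)"
    unfolding sibuya_Suc by (rule telescope_sums'[OF sibuya_tail_tendsto_0[OF assms]])
  then show ?thesis
    by (simp add: sums_Suc_iff sibuya_0 sibuya_tail_def)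
qed

text \<open>The left side is what the Gamma integral produces from the \<open>k\<close>-th term of the heat series. The
  functional equation of \<open>Gamma\<close> turns the quotient \<open>Gamma (k - s) / Gamma (1 - s)\<close> into the product
  \<open>(1 - s) (2 - s) \<dots> (k - 1 - s)\<close>.\<close>

lemma sibuya_eq_Gamma:
  assumes "0 < s" "s < 1" "0 < k"
  shows "s / Gamma (1 - s) * (Gamma (real k - s) / fact k) = sibuya s k"
proof -
  have *: "Gamma (real (Suc n) - s) = Gamma (1 - s) * fact n * sibuya_tail s n" for n
  proof (induction n)
    case (Suc n)
    have "real (Suc n) - s \<notin> \<int>\<^sub>\<le>\<^sub>0"
      using assms by (auto simp: nonpos_Ints_def)
    then have "Gamma (real (Suc (Suc n)) - s) = (real (Suc n) - s) * Gamma (real (Suc n) - s)"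
      using Gamma_plus1[of "real (Suc n) - s"] by (simp add: algebra_simps)
    also have "\<dots> = Gamma (1 - s) * fact (Suc n) * (sibuya_tail s n * (1 - s / real (Suc n)))"
      unfolding Suc.IH by (simp add: field_simps)
    also have "sibuya_tail s n * (1 - s / real (Suc n)) = sibuya_tail s (Suc n)"
      by (simp add: sibuya_tail_def)
    finally show ?case .
  qed (simp add: sibuya_tail_def)
  obtain n where n: "k = Suc n" using assms by (cases k) auto
  have "0 < Gamma (1 - s)" by (rule Gamma_real_pos) (use assms in simp)
  then show ?thesis
    unfolding n * sibuya_def by (simp add: field_simps del: of_nat_Suc)
qed

lemma sibuya_summable_bounded:
  assumes "0 < s" "s < 1" "\<And>k. \<bar>b k\<bar> \<le> C"
  shows "summable (\<lambda>k. sibuya s k * b k)"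
proof (rule summable_comparison_test')
  show "summable (\<lambda>k. sibuya s k * C)"
    using sibuya_sums_1[OF assms(1,2)] by (intro summable_mult2) (auto simp: sums_iff)
  show "norm (sibuya s k * b k) \<le> sibuya s k * C" for k
    using assms(3) sibuya_nonneg[OF assms(1,2)] by (auto simp: abs_mult intro: mult_left_mono)
qed

text \<open>As \<open>s\<close> tends to \<open>0\<close> each weight is at most \<open>s\<close>, so the contribution of any finite initial segment
  tends to \<open>0\<close>; the total weight is \<open>1\<close>, so the rest contributes at most the supremum of the late \<open>\<bar>b k\<bar>\<close>.\<close>

lemma sibuya_mean_tendsto_0:
  assumes b: "b \<longlonglongrightarrow> 0" and C: "\<And>k. \<bar>b k\<bar> \<le> C"
  shows "((\<lambda>s. \<Sum>k. sibuya s k * b k) \<longlongrightarrow> 0) (at_right 0)"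
proof (rule tendstoI)
  fix e :: real assume e: "0 < e"
  obtain N where N: "\<And>k. k \<ge> N \<Longrightarrow> \<bar>b k\<bar> < e / 2"
    using LIMSEQ_D[OF b, of "e / 2"] e by auto
  have "((\<lambda>s. real N * (s * C) + e / 2) \<longlongrightarrow> real N * (0 * C) + e / 2) (at_right 0)"
    by (intro tendsto_intros)
  then have "\<forall>\<^sub>F s in at_right 0. real N * (s * C) + e / 2 < e"
    by (rule order_tendstoD) (use e in simp)
  moreover have "\<forall>\<^sub>F s in at_right (0::real). 0 < s \<and> s < 1"
    by (auto simp: eventually_at_right_field intro!: exI[of _ 1])
  ultimately show "\<forall>\<^sub>F s in at_right 0. dist (\<Sum>k. sibuya s k * b k) 0 < e"
  proof eventually_elim
    case (elim s)
    then have s: "0 < s" "s < 1" by auto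
    \<comment> \<open>Majorant: weight \<open>s\<close> and value \<open>C\<close> before \<open>N\<close>, value \<open>e / 2\<close> throughout.\<close>
    have sums: "(\<lambda>k. (if k \<in> {..<N} then s * C else 0) + sibuya s k * (e / 2))
        sums ((\<Sum>k<N. s * C) + 1 * (e / 2))"
      by (intro sums_add sums_If_finite_set sums_mult2 sibuya_sums_1 s) auto
    have "\<bar>sibuya s k * b k\<bar> \<le> (if k \<in> {..<N} then s * C else 0) + sibuya s k * (e / 2)" for k
    proof (cases "k < N")
      case True
      have "sibuya s k * \<bar>b k\<bar> \<le> s * C"
        using s C[of k] sibuya_le[OF s] sibuya_nonneg[OF s] by (intro mult_mono) auto
      then show ?thesis
        using True sibuya_nonneg[OF s, of k] e by (simp add: abs_mult add_increasing2)
    next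
      case False
      have "sibuya s k * \<bar>b k\<bar> \<le> sibuya s k * (e / 2)"
        using N[of k] False sibuya_nonneg[OF s] by (intro mult_left_mono) auto
      then show ?thesis
        using False sibuya_nonneg[OF s, of k] by (simp add: abs_mult)
    qed
    then have "norm (\<Sum>k. sibuya s k * b k)
        \<le> (\<Sum>k. (if k \<in> {..<N} then s * C else 0) + sibuya s k * (e / 2))"
      using sums by (intro norm_suminf_le) (auto simp: sums_iff)
    also have "\<dots> = real N * (s * C) + e / 2"
      using sums by (simp add: sums_iff)
    also have "\<dots> < e" using elim by simp
    finally show ?case by simp
  qed
qed

section \<open>The heat semigroup\<close>

lemma l2_diff:
  assumes m: "\<And>x. 0 \<le> m x" and f: "f \<in> l2 m" and g: "g \<in> l2 m"
  shows "(\<lambda>x. f x - g x) \<in> l2 m"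
proof -
  have "(\<lambda>x. 2 * ((f x)\<^sup>2 * m x) + 2 * ((g x)\<^sup>2 * m x)) summable_on UNIV"
    using f g by (intro summable_on_add summable_on_cmult_right) (auto simp: l2_def)
  then have "(\<lambda>x. (f x - g x)\<^sup>2 * m x) summable_on UNIV"
  proof (rule summable_on_comparison_test)
    fix x
    have "(f x - g x)\<^sup>2 \<le> 2 * (f x)\<^sup>2 + 2 * (g x)\<^sup>2"
      using zero_le_power2[of "f x + g x"] by (simp add: power2_eq_square algebra_simps)
    from mult_right_mono[OF this m[of x]]
    show "(f x - g x)\<^sup>2 * m x \<le> 2 * ((f x)\<^sup>2 * m x) + 2 * ((g x)\<^sup>2 * m x)"
      by (simp add: algebra_simps)
  qed (use m in auto)
  then show ?thesis by (simp add: l2_def)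
qed

lemma l2_coordinate_le:
  assumes m: "\<And>x. 0 \<le> m x" and f: "f \<in> l2 m"
  shows "sqrt (m x) * \<bar>f x\<bar> \<le> l2_norm m f"
proof -
  have "(\<Sum>x\<in>{x}. (f x)\<^sup>2 * m x) \<le> (\<Sum>\<^sub>\<infinity>x. (f x)\<^sup>2 * m x)"
    using f m by (intro finite_sum_le_infsum) (auto simp: l2_def)
  then have "sqrt ((f x)\<^sup>2 * m x) \<le> l2_norm m f"
    unfolding l2_norm_def by (intro real_sqrt_le_mono) simp
  then show ?thesis by (simp add: real_sqrt_mult mult.commute)
qed

text \<open>A criterion for the exponential in \<open>l2 m\<close> to be the pointwise exponential series. Bounds on the
  terms in both the supremum norm and the \<open>\<ell>\<^sup>1(m)\<close> norm suffice, because a remainder \<open>r\<close> satisfies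
  \<open>\<parallel>r\<parallel>\<^sub>2\<^sup>2 \<le> \<parallel>r\<parallel>\<^sub>\<infinity> \<parallel>r\<parallel>\<^sub>1\<close>. Uniqueness holds
  because convergence in \<open>l2 m\<close> implies pointwise convergence.\<close>

lemma l2_exp_eqI:
  fixes m :: "'a \<Rightarrow> real"
  assumes m: "\<And>x. 0 < m x"
    and sup: "\<And>k x. \<bar>(A ^^ k) u x / fact k\<bar> \<le> c k"
    and mass: "\<And>k B. finite B \<Longrightarrow> (\<Sum>x\<in>B. m x * \<bar>(A ^^ k) u x / fact k\<bar>) \<le> M * c k"
    and c: "summable c"
  shows "l2_exp m A u = (\<lambda>x. \<Sum>k. (A ^^ k) u x / fact k)"
proof -
  define e where "e = (\<lambda>k x. (A ^^ k) u x / fact k)"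
  define v where "v = (\<lambda>x. \<Sum>k. e k x)"
  define r where "r = (\<lambda>n x. (\<Sum>k<n. e k x) - v x)"
  define T where "T = (\<lambda>n. \<Sum>k. c (k + n))"
  have m0: "0 \<le> m x" for x using m[of x] by simp
  have sup': "\<bar>e k x\<bar> \<le> c k" for k x using sup by (simp add: e_def)
  have c0: "0 \<le> c k" for k using sup'[of k undefined] by linarith
  have c_shift: "summable (\<lambda>k. c (k + n))" for n
    using c by (simp add: summable_iff_shift)
  have e_abs: "summable (\<lambda>k. \<bar>e (k + n) x\<bar>)" for n x
    by (rule summable_comparison_test'[OF c_shift[of n]]) (simp add: sup')
  have e_sum: "summable (\<lambda>k. e k x)" for x
    using e_abs[of 0 x] by (auto intro: summable_rabs_cancel)
  have T_lim: "T \<longlonglongrightarrow> 0"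
  proof -
    have "(\<lambda>n. suminf c - (\<Sum>k<n. c k)) \<longlonglongrightarrow> suminf c - suminf c"
      by (intro tendsto_intros summable_LIMSEQ c)
    then show ?thesis
      by (simp add: T_def suminf_minus_initial_segment[OF c])
  qed
  have T0: "0 \<le> T n" for n
    unfolding T_def by (intro suminf_nonneg c_shift c0)
  have r_eq: "\<bar>r n x\<bar> \<le> (\<Sum>k. \<bar>e (k + n) x\<bar>)" for n x
    using summable_rabs[OF e_abs, of n x]
    by (simp add: r_def v_def suminf_minus_initial_segment[OF e_sum] abs_minus_commute)
  have r_sup: "\<bar>r n x\<bar> \<le> T n" for n x
    using r_eq[of n x] suminf_le[OF _ e_abs c_shift, of n x n] sup' by (fastforce simp: T_def)
  have r_mass: "(\<Sum>x\<in>B. m x * \<bar>r n x\<bar>) \<le> M * T n" if B: "finite B" for n B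
  proof -
    have "(\<Sum>x\<in>B. m x * \<bar>r n x\<bar>) \<le> (\<Sum>x\<in>B. m x * (\<Sum>k. \<bar>e (k + n) x\<bar>))"
      by (intro sum_mono mult_left_mono r_eq m0)
    also have "\<dots> = (\<Sum>x\<in>B. \<Sum>k. m x * \<bar>e (k + n) x\<bar>)"
      by (simp add: suminf_mult[OF e_abs])
    also have "\<dots> = (\<Sum>k. \<Sum>x\<in>B. m x * \<bar>e (k + n) x\<bar>)"
      by (rule suminf_sum[symmetric]) (rule summable_mult[OF e_abs])
    also have "\<dots> \<le> (\<Sum>k. M * c (k + n))"
      using mass[OF B] summable_mult[OF e_abs] summable_mult[OF c_shift]
      by (intro suminf_le summable_sum) (auto simp: e_def)
    also have "\<dots> = M * T n"
      unfolding T_def by (rule suminf_mult[OF c_shift])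
    finally show ?thesis .
  qed
  have r_energy: "(\<Sum>x\<in>B. (r n x)\<^sup>2 * m x) \<le> M * (T n)\<^sup>2" if B: "finite B" for n B
  proof -
    have "(\<Sum>x\<in>B. (r n x)\<^sup>2 * m x) = (\<Sum>x\<in>B. \<bar>r n x\<bar> * (m x * \<bar>r n x\<bar>))"
      by (intro sum.cong refl) (auto simp: power2_eq_square abs_mult_self_eq)
    also have "\<dots> \<le> (\<Sum>x\<in>B. T n * (m x * \<bar>r n x\<bar>))"
      by (intro sum_mono mult_right_mono r_sup mult_nonneg_nonneg m0) auto
    also have "\<dots> = T n * (\<Sum>x\<in>B. m x * \<bar>r n x\<bar>)"
      by (simp add: sum_distrib_left)
    also have "\<dots> \<le> T n * (M * T n)"
      by (intro mult_left_mono r_mass B T0)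
    finally show ?thesis by (simp add: power2_eq_square mult_ac)
  qed
  have r_l2: "r n \<in> l2 m" for n
    unfolding l2_def mem_Collect_eq
    by (rule nonneg_bounded_partial_sums_imp_summable_on[where C = "M * (T n)\<^sup>2"])
       (use r_energy m0 in \<open>auto simp: eventually_finite_subsets_at_top\<close>)
  \<comment> \<open>The empty partial sum already shows that the limit is square summable.\<close>
  have "r 0 = (\<lambda>x. - v x)" by (simp add: r_def)
  then have v_l2: "v \<in> l2 m"
    using r_l2[of 0] by (simp add: l2_def)
  have r_lim: "(\<lambda>n. l2_norm m (r n)) \<longlonglongrightarrow> 0"
  proof (rule tendsto_sandwich[OF _ _ tendsto_const])
    show "\<forall>\<^sub>F n in sequentially. 0 \<le> l2_norm m (r n)"
      by (simp add: l2_norm_def infsum_nonneg m0)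
    show "\<forall>\<^sub>F n in sequentially. l2_norm m (r n) \<le> sqrt (M * (T n)\<^sup>2)"
      unfolding l2_norm_def
      using r_l2 r_energy
      by (intro always_eventually allI real_sqrt_le_mono infsum_le_finite_sums) (auto simp: l2_def)
    have "(\<lambda>n. sqrt (M * (T n)\<^sup>2)) \<longlonglongrightarrow> sqrt (M * 0\<^sup>2)"
      by (intro tendsto_intros T_lim)
    then show "(\<lambda>n. sqrt (M * (T n)\<^sup>2)) \<longlonglongrightarrow> 0" by simp
  qed
  have "l2_exp m A u = v"
    unfolding l2_exp_def
  proof (rule the_equality)
    show "v \<in> l2 m \<and> (\<lambda>n. l2_norm m (\<lambda>x. (\<Sum>k<n. (A ^^ k) u x / fact k) - v x)) \<longlonglongrightarrow> 0"
      using v_l2 r_lim by (simp add: r_def e_def)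
  next
    fix v'
    assume v': "v' \<in> l2 m \<and> (\<lambda>n. l2_norm m (\<lambda>x. (\<Sum>k<n. (A ^^ k) u x / fact k) - v' x)) \<longlonglongrightarrow> 0"
    define r' where "r' = (\<lambda>n x. (\<Sum>k<n. e k x) - v' x)"
    have r'_lim: "(\<lambda>n. l2_norm m (r' n)) \<longlonglongrightarrow> 0"
      using v' by (simp add: r'_def e_def)
    \<comment> \<open>Square summability of \<open>r' n\<close> matters: otherwise the infinite sum in its norm would be \<open>0\<close> by
      convention, and small norms would say nothing about the values.\<close>
    have "(\<lambda>x. r n x - (v' x - v x)) \<in> l2 m" for n
      using v' by (intro l2_diff m0 r_l2 v_l2) auto
    then have r'_l2: "r' n \<in> l2 m" for n
      by (simp add: r_def r'_def algebra_simps)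
    show "v' = v"
    proof
      fix x
      have "(\<lambda>n. l2_norm m (r' n) / sqrt (m x)) \<longlonglongrightarrow> 0 / sqrt (m x)"
        using m[of x] by (intro tendsto_intros r'_lim) auto
      then have lim: "(\<lambda>n. l2_norm m (r' n) / sqrt (m x)) \<longlonglongrightarrow> 0" by simp
      have "(\<lambda>n. r' n x) \<longlonglongrightarrow> 0"
        by (rule Lim_null_comparison[OF always_eventually lim])
           (use l2_coordinate_le[OF m0 r'_l2] m[of x] in \<open>auto simp: field_simps\<close>)
      then have "(\<lambda>n. r' n x + v' x) \<longlonglongrightarrow> 0 + v' x"
        by (intro tendsto_intros)
      then have "(\<lambda>n. \<Sum>k<n. e k x) \<longlonglongrightarrow> v' x"
        by (simp add: r'_def)
      moreover have "(\<lambda>n. \<Sum>k<n. e k x) \<longlonglongrightarrow> v x"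
        unfolding v_def by (rule summable_LIMSEQ[OF e_sum])
      ultimately show "v' x = v x" by (rule LIMSEQ_unique)
    qed
  qed
  then show ?thesis by (simp add: v_def e_def)
qed

context weighted_lattice
begin

lemma normalized_laplacian_eq: "normalized_laplacian w f x = avg f x - f x"
proof -
  have "(\<Sum>y | lattice_adj x y. w x y * (f y - f x))
      = (\<Sum>y | lattice_adj x y. w x y * f y) - \<mu> x * f x"
    by (simp add: right_diff_distrib sum_subtractf vertex_measure_def sum_distrib_right)
  then show ?thesis
    using mu_pos[of x] by (simp add: normalized_laplacian_def avg_def diff_divide_distrib)
qed

lemma avg_sum: "avg (\<lambda>x. \<Sum>j\<in>J. c j * f j x) x = (\<Sum>j\<in>J. c j * avg (f j) x)"
proof -
  have "(\<Sum>y | lattice_adj x y. w x y * (\<Sum>j\<in>J. c j * f j y))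
      = (\<Sum>y | lattice_adj x y. \<Sum>j\<in>J. c j * (w x y * f j y))"
    by (simp add: sum_distrib_left mult_ac)
  also have "\<dots> = (\<Sum>j\<in>J. c j * (\<Sum>y | lattice_adj x y. w x y * f j y))"
    by (subst sum.swap) (simp add: sum_distrib_left)
  finally show ?thesis
    by (simp only: avg_def sum_divide_distrib[of _ J] times_divide_eq_right)
qed

text \<open>The binomial formula for \<open>t\<^sup>k (P - I)\<^sup>k\<close>, applied to \<open>1\<^sub>y\<close>. The sign is written with \<open>k + j\<close> rather than
  \<open>k - j\<close> to avoid truncated subtraction in the induction.\<close>

lemma laplacian_power_indicator:
  "((\<lambda>u x. t * normalized_laplacian w u x) ^^ k) (indicator {y}) x
     = t ^ k * (\<Sum>j\<le>k. (-1) ^ (k + j) * real (k choose j) * walk j y x)"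
proof (induction k arbitrary: x)
  case 0
  then show ?case by (simp add: walk_0)
next
  case (Suc k)
  let ?b = "\<lambda>k j. (-1) ^ (k + j) * real (k choose j)"
  let ?D = "\<lambda>k x. t ^ k * (\<Sum>j\<le>k. ?b k j * walk j y x)"
  have "((\<lambda>u x. t * normalized_laplacian w u x) ^^ k) (indicator {y}) = ?D k"
    by (rule ext) (rule Suc.IH)
  then have "((\<lambda>u x. t * normalized_laplacian w u x) ^^ Suc k) (indicator {y}) x
      = t * (avg (?D k) x - ?D k x)"
    by (simp only: funpow.simps o_apply normalized_laplacian_eq)
  also have "avg (?D k) x = t ^ k * (\<Sum>j\<le>k. ?b k j * walk (Suc j) y x)"
    using avg_sum[of "\<lambda>j. t ^ k * ?b k j" "\<lambda>j. walk j y" "{..k}" x]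
    by (simp add: walk_Suc sum_distrib_left mult.assoc)
  also have "t * (t ^ k * (\<Sum>j\<le>k. ?b k j * walk (Suc j) y x) - ?D k x)
      = t ^ Suc k * ((\<Sum>j\<le>k. ?b k j * walk (Suc j) y x) - (\<Sum>j\<le>Suc k. ?b k j * walk j y x))"
    by (simp add: algebra_simps)
  also have "(\<Sum>j\<le>k. ?b k j * walk (Suc j) y x) - (\<Sum>j\<le>Suc k. ?b k j * walk j y x)
      = (\<Sum>j\<le>k. ?b k j * walk (Suc j) y x - ?b k (Suc j) * walk (Suc j) y x) - ?b k 0 * walk 0 y x"
    by (subst sum.atMost_Suc_shift) (simp add: sum.distrib sum_negf)
  also have "\<dots> = (\<Sum>j\<le>Suc k. ?b (Suc k) j * walk j y x)"
    by (subst sum.atMost_Suc_shift) (simp add: algebra_simps)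
  finally show ?case .
qed

lemma sum_choose_walk_bound:
  "\<bar>\<Sum>j\<le>k. (-1) ^ (k + j) * real (k choose j) * walk j y x\<bar>
    \<le> (\<Sum>j\<le>k. real (k choose j) * walk j y x)"
  by (rule order.trans[OF sum_abs]) (simp add: abs_mult walk_nonneg)

text \<open>This is \<open>exp (t (P - I)) = exp (-t) exp (t P)\<close>. Both norms of the \<open>k\<close>-th term of the exponential
  series carry a factor \<open>2\<^sup>k\<close>, the sum of the binomial coefficients, so \<open>l2_exp_eqI\<close> applies; the
  factor \<open>exp (-t)\<close> is then split off by a Cauchy product.\<close>

lemma heat_semigroup_indicator:
  assumes "0 \<le> t"
  shows "heat_semigroup w t (indicator {y}) x = exp (- t) * (\<Sum>k. t ^ k / fact k * walk k y x)"
proof -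
  let ?A = "\<lambda>u x. t * normalized_laplacian w u x"
  let ?e = "\<lambda>k x. (?A ^^ k) (indicator {y}) x / fact k"
  let ?c = "\<lambda>k. (2 * t) ^ k / fact k"
  have bound: "\<bar>?e k x\<bar> \<le> t ^ k / fact k * (\<Sum>j\<le>k. real (k choose j) * walk j y x)" for k x
    unfolding laplacian_power_indicator
    using mult_left_mono[OF sum_choose_walk_bound[of k y x], of "t ^ k / fact k"] assms
    by (simp add: abs_mult)
  have choose: "(\<Sum>j\<le>k. real (k choose j)) = 2 ^ k" for k
    by (metis choose_row_sum of_nat_numeral of_nat_power of_nat_sum)
  have "l2_exp \<mu> ?A (indicator {y}) = (\<lambda>x. \<Sum>k. ?e k x)"
  proof (rule l2_exp_eqI[where c = ?c and M = "\<mu> y"])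
    show "\<bar>?e k x\<bar> \<le> ?c k" for k x
    proof -
      have "(\<Sum>j\<le>k. real (k choose j) * walk j y x) \<le> (\<Sum>j\<le>k. real (k choose j) * 1)"
        by (intro sum_mono mult_left_mono walk_le_1) auto
      also have "\<dots> = 2 ^ k" using choose by simp
      finally have "t ^ k / fact k * (\<Sum>j\<le>k. real (k choose j) * walk j y x) \<le> t ^ k / fact k * 2 ^ k"
        using assms by (intro mult_left_mono) auto
      then show ?thesis using bound[of k x] by (simp add: power_mult_distrib mult.commute)
    qed
    show "(\<Sum>x\<in>B. \<mu> x * \<bar>?e k x\<bar>) \<le> \<mu> y * ?c k" if "finite B" for k B
    proof -
      have "(\<Sum>x\<in>B. \<mu> x * \<bar>?e k x\<bar>)
          \<le> (\<Sum>x\<in>B. \<mu> x * (t ^ k / fact k * (\<Sum>j\<le>k. real (k choose j) * walk j y x)))"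
        by (intro sum_mono mult_left_mono bound) (auto simp: mu_pos less_imp_le)
      also have "\<dots> = (\<Sum>x\<in>B. \<Sum>j\<le>k. t ^ k / fact k * real (k choose j) * (\<mu> x * walk j y x))"
        by (simp add: sum_distrib_left mult_ac)
      also have "\<dots> = (\<Sum>j\<le>k. t ^ k / fact k * real (k choose j) * (\<Sum>x\<in>B. \<mu> x * walk j y x))"
        by (subst sum.swap) (simp add: sum_distrib_left)
      also have "\<dots> \<le> (\<Sum>j\<le>k. t ^ k / fact k * real (k choose j) * \<mu> y)"
        using that assms by (intro sum_mono mult_left_mono walk_mass_le) auto
      also have "\<dots> = t ^ k / fact k * (\<Sum>j\<le>k. real (k choose j)) * \<mu> y"
        by (simp add: sum_distrib_left sum_distrib_right)
      also have "\<dots> = \<mu> y * ?c k"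
        unfolding choose by (simp add: power_mult_distrib)
      finally show ?thesis .
    qed
    show "summable ?c"
      using summable_exp[of "2 * t"] by (simp add: divide_inverse mult.commute)
  qed (rule mu_pos)
  then have "heat_semigroup w t (indicator {y}) x = (\<Sum>k. ?e k x)"
    by (simp add: heat_semigroup_def)
  also have "\<dots> = (\<Sum>k. t ^ k / fact k * walk k y x) * (\<Sum>k. (- t) ^ k / fact k)"
  proof -
    have "(\<lambda>k. \<Sum>j\<le>k. (t ^ j / fact j * walk j y x) * ((- t) ^ (k - j) / fact (k - j))) sums
        ((\<Sum>k. t ^ k / fact k * walk k y x) * (\<Sum>k. (- t) ^ k / fact k))"
    proof (rule Cauchy_product_sums)
      have s: "summable (\<lambda>k. t ^ k / fact k)"
        using summable_exp[of t] by (simp add: divide_inverse mult.commute)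
      show "summable (\<lambda>k. norm ((- t) ^ k / fact k))"
        using s assms by (simp add: power_abs)
      show "summable (\<lambda>k. norm (t ^ k / fact k * walk k y x))"
        by (rule summable_comparison_test'[OF s])
           (use assms walk_nonneg walk_le_1 in \<open>auto simp: abs_mult divide_simps intro!: mult_left_le\<close>)
    qed
    moreover have "(\<Sum>j\<le>k. (t ^ j / fact j * walk j y x) * ((- t) ^ (k - j) / fact (k - j))) = ?e k x" for k
    proof -
      have "(t ^ j / fact j * walk j y x) * ((- t) ^ (k - j) / fact (k - j))
          = t ^ k * ((-1) ^ (k + j) * real (k choose j) * walk j y x) / fact k" if "j \<le> k" for j
      proof -
        have "(- t) ^ (k - j) = (-1) ^ (k - j) * t ^ (k - j)"
          by (simp add: power_mult_distrib[symmetric])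
        moreover have "(-1 :: real) ^ (k - j) = (-1) ^ (k + j)"
          using that by (simp add: minus_one_power_iff)
        moreover have "t ^ k = t ^ j * t ^ (k - j)"
          using that by (simp add: power_add[symmetric])
        ultimately show ?thesis
          using that by (simp add: binomial_fact)
      qed
      then show ?thesis
        unfolding laplacian_power_indicator by (simp add: sum_distrib_left sum_divide_distrib)
    qed
    ultimately show ?thesis by (simp add: sums_iff)
  qed
  also have "(\<Sum>k. (- t) ^ k / fact k) = exp (- t)"
    by (simp add: exp_def divide_inverse mult.commute)
  finally show ?thesis by (simp add: mult.commute)
qed

end

section \<open>The fractional Laplacian as a Sibuya mean\<close>

lemma has_bochner_integral_Gamma:
  fixes z :: real
  assumes "0 < z"
  shows "has_bochner_integral lborel (\<lambda>t. indicator {0<..} t * (t powr (z - 1) / exp t)) (Gamma z)"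
proof (rule has_bochner_integral_nn_integral)
  have "(\<integral>\<^sup>+ t. ennreal (indicator {0<..} t * (t powr (z - 1) / exp t)) \<partial>lborel)
      = (\<integral>\<^sup>+ t. ennreal (indicator {0..} t * t powr (z - 1) / exp t) \<partial>lborel)"
    by (intro nn_integral_cong) (auto simp: indicator_def)
  then show "(\<integral>\<^sup>+ t. ennreal (indicator {0<..} t * (t powr (z - 1) / exp t)) \<partial>lborel) = ennreal (Gamma z)"
    using Gamma_conv_nn_integral_real[OF assms] by simp
  show "0 \<le> Gamma z" using Gamma_real_pos[OF assms] by simp
qed auto

context weighted_lattice
begin

lemma summable_sibuya_walk:
  "0 < s \<Longrightarrow> s < 1 \<Longrightarrow> summable (\<lambda>k. sibuya s k * walk k y x)"
  by (rule sibuya_summable_bounded[where C = 1]) (auto simp: walk_nonneg walk_le_1)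

lemma summable_exp_walk:
  assumes "0 \<le> t"
  shows "summable (\<lambda>k. t ^ k / fact k * walk k y x)"
proof (rule summable_comparison_test')
  show "summable (\<lambda>k. t ^ k / fact k)"
    using summable_exp[of t] by (simp add: divide_inverse mult.commute)
  show "norm (t ^ k / fact k * walk k y x) \<le> t ^ k / fact k" for k
    using mult_left_mono[OF walk_le_1[of k y x], of "t ^ k / fact k"] assms
    by (simp add: abs_mult walk_nonneg)
qed

text \<open>Termwise integration of the heat series. Off the diagonal the term \<open>k = 0\<close>, whose integral would
  diverge at \<open>0\<close>, has coefficient \<open>walk 0 y x = 0\<close>; the other terms are Gamma integrals with value
  \<open>Gamma (k - s)\<close>. All terms are nonnegative and the integrals are summable, so sum and integral
  commute.\<close>

lemma frac_weight_eq_sibuya_mean: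
  assumes s: "0 < s" "s < 1" and "x \<noteq> y"
  shows "frac_weight w s x y = \<mu> x * (\<Sum>k. sibuya s k * walk k y x)"
proof -
  have walk0: "walk 0 y x = 0" using assms by (simp add: walk_0)
  \<comment> \<open>\<open>g k\<close> is the integrand of the \<open>k\<close>-th term, with the powers of \<open>t\<close> merged.\<close>
  define a where "a = (\<lambda>k. walk k y x / fact k / \<mu> y)"
  define g where "g = (\<lambda>k t. indicator {0<..} t * (t powr (real k - s - 1) / exp t) * a k)"
  have a_nonneg: "0 \<le> a k" for k
    by (simp add: a_def walk_nonneg mu_pos less_imp_le)
  have g: "has_bochner_integral lborel (g k) (Gamma (real k - s) * a k)" for k
  proof (cases "k = 0")
    case True
    then show ?thesis by (simp add: g_def a_def walk0 has_bochner_integral_zero)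
  next
    case False
    then show ?thesis
      unfolding g_def using s
      by (intro has_bochner_integral_mult_left has_bochner_integral_Gamma) auto
  qed
  have Gamma_a: "s / Gamma (1 - s) * (Gamma (real k - s) * a k) = sibuya s k * walk k y x / \<mu> y" for k
  proof (cases "k = 0")
    case False
    then show ?thesis
      using sibuya_eq_Gamma[OF s, of k, symmetric] by (simp add: a_def mult_ac)
  qed (simp add: a_def walk0)
  have Gamma_ne_0: "Gamma (1 - s) \<noteq> 0"
    by (rule less_imp_neq[OF Gamma_real_pos, THEN not_sym]) (use s in simp)
  then have Gamma_a': "Gamma (real k - s) * a k = Gamma (1 - s) / s * (sibuya s k * walk k y x / \<mu> y)" for k
    unfolding Gamma_a[symmetric] using s by simp
  have g_sums: "(\<lambda>k. g k t) sums (indicator {0<..} t * (heat_kernel w t x y * t powr (- 1 - s)))" for t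
  proof (cases "0 < t")
    case True
    have "(\<lambda>k. exp (- t) * t powr (- 1 - s) / \<mu> y * (t ^ k / fact k * walk k y x)) sums
        (exp (- t) * t powr (- 1 - s) / \<mu> y * (\<Sum>k. t ^ k / fact k * walk k y x))"
      using True by (intro sums_mult summable_sums summable_exp_walk) auto
    moreover have "exp (- t) * t powr (- 1 - s) / \<mu> y * (t ^ k / fact k * walk k y x) = g k t" for k
    proof -
      have "t powr (real k - s - 1) = t ^ k * t powr (- 1 - s)"
        using True powr_add[of t "real k" "- 1 - s"] by (simp add: powr_realpow algebra_simps)
      then show ?thesis
        using True by (simp add: g_def a_def exp_minus divide_inverse mult_ac)
    qed
    ultimately show ?thesis
      using True by (simp add: heat_kernel_def heat_semigroup_indicator mult_ac)
  qed (simp add: g_def)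
  have g_nonneg: "0 \<le> g k t" for k t
    unfolding g_def by (intro mult_nonneg_nonneg a_nonneg) auto
  have int: "integral\<^sup>L lborel (g k) = Gamma (1 - s) / s * (sibuya s k * walk k y x / \<mu> y)" for k
    using g[of k] unfolding Gamma_a' by (rule has_bochner_integral_integral_eq)
  have "(\<integral>t. (\<Sum>k. g k t) \<partial>lborel) = (\<Sum>k. integral\<^sup>L lborel (g k))"
  proof (rule integral_suminf)
    show "integrable lborel (g k)" for k
      using g[of k] by (simp add: has_bochner_integral_iff)
    show "AE t in lborel. summable (\<lambda>k. norm (g k t))"
      using g_sums g_nonneg by (auto simp: sums_iff)
    show "summable (\<lambda>k. \<integral>t. norm (g k t) \<partial>lborel)"
      using g_nonneg by (simp add: int summable_mult summable_divide summable_sibuya_walk s)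
  qed
  then have "(LBINT t:{0<..}. heat_kernel w t x y * t powr (- 1 - s))
      = (\<Sum>k. Gamma (1 - s) / s * (sibuya s k * walk k y x / \<mu> y))"
    using g_sums by (simp add: set_lebesgue_integral_def sums_iff int)
  also have "\<dots> = Gamma (1 - s) / s * ((\<Sum>k. sibuya s k * walk k y x) / \<mu> y)"
    using summable_sibuya_walk[OF s]
    by (simp add: suminf_mult suminf_divide summable_divide del: times_divide_eq_left times_divide_eq_right)
  finally show ?thesis
    using Gamma_ne_0 s mu_pos[of y] by (simp add: frac_weight_def field_simps)
qed

text \<open>The position of the walk at an independent Sibuya distributed time is again a probability
  distribution: exchange two nonnegative sums, using that each \<open>walk k\<close> has total probability \<open>1\<close>.\<close>

lemma sibuya_walk_has_sum_1:
  assumes s: "0 < s" "s < 1"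
  shows "((\<lambda>y. \<Sum>k. sibuya s k * walk k y x) has_sum 1) UNIV"
proof -
  let ?f = "\<lambda>(k, y). sibuya s k * walk k y x"
  have row: "((\<lambda>y. ?f (k, y)) has_sum sibuya s k * 1) UNIV" for k
    unfolding prod.case by (rule has_sum_cmult_right[OF walk_has_sum_1])
  have total: "((\<lambda>k. sibuya s k * 1) has_sum 1) UNIV"
    using sibuya_sums_1[OF s] sibuya_nonneg[OF s] by (simp add: sums_nonneg_imp_has_sum)
  have summable: "?f summable_on UNIV \<times> UNIV"
    by (rule summable_on_SigmaI[OF row])
       (use total sibuya_nonneg[OF s] walk_nonneg in \<open>auto simp: summable_on_def\<close>)
  have "(?f has_sum 1) (UNIV \<times> UNIV)"
    by (rule has_sum_SigmaI[OF row total summable])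
  then have "((\<lambda>(y, k). ?f (k, y)) has_sum 1) (UNIV \<times> UNIV)"
    by (subst (asm) has_sum_swap) simp
  moreover have "((\<lambda>k. (\<lambda>(y, k). ?f (k, y)) (y, k)) has_sum (\<Sum>k. sibuya s k * walk k y x)) UNIV" for y
    unfolding prod.case
    by (intro sums_nonneg_imp_has_sum summable_sums summable_sibuya_walk s mult_nonneg_nonneg
        sibuya_nonneg walk_nonneg)
  ultimately show ?thesis
    by (rule has_sum_SigmaD)
qed

text \<open>This is \<open>(-\<Delta>)\<^sup>s = I - (\<Sum>k. sibuya s k P\<^sup>k)\<close>. The sum over \<open>y \<noteq> x\<close> may be extended to all \<open>y\<close>
  since the factor \<open>u x - u y\<close> vanishes at \<open>y = x\<close>.\<close>

lemma frac_laplacian_eq: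
  assumes s: "0 < s" "s < 1" and u: "finite {y. u y \<noteq> 0}"
  shows "frac_laplacian w s u x = u x - (\<Sum>y | u y \<noteq> 0. u y * (\<Sum>k. sibuya s k * walk k y x))"
proof -
  let ?G = "\<lambda>y. \<Sum>k. sibuya s k * walk k y x"
  let ?S = "\<Sum>y | u y \<noteq> 0. u y * ?G y"
  have "((\<lambda>y. u y * ?G y) has_sum ?S) UNIV"
    by (rule has_sum_finite_neutralI[OF u]) auto
  then have "((\<lambda>y. \<mu> x * (?G y * u x + (-1) * (u y * ?G y))) has_sum
      (\<mu> x * (1 * u x + (-1) * ?S))) UNIV"
    by (intro has_sum_cmult_right has_sum_add has_sum_cmult_left sibuya_walk_has_sum_1 s)
  also have "?this \<longleftrightarrow> ((\<lambda>y. frac_weight w s x y * (u x - u y)) has_sum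
      (\<mu> x * (1 * u x + (-1) * ?S))) (- {x})"
    by (rule has_sum_cong_neutral) (auto simp: frac_weight_eq_sibuya_mean s algebra_simps)
  finally show ?thesis
    using mu_pos[of x] by (simp add: frac_laplacian_def infsumI mult.commute)
qed

lemma frac_laplacian_tendsto:
  assumes "finite {y. u y \<noteq> 0}"
  shows "((\<lambda>s. frac_laplacian w s u x) \<longlongrightarrow> u x) (at_right 0)"
proof -
  have "((\<lambda>s. u x - (\<Sum>y | u y \<noteq> 0. u y * (\<Sum>k. sibuya s k * walk k y x)))
      \<longlongrightarrow> u x - (\<Sum>y | u y \<noteq> 0. u y * 0)) (at_right 0)"
    by (intro tendsto_intros sibuya_mean_tendsto_0[where C = 1] walk_tendsto_0)
       (simp add: walk_nonneg walk_le_1)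
  moreover have "\<forall>\<^sub>F s in at_right (0::real). 0 < s \<and> s < 1"
    by (auto simp: eventually_at_right_field intro!: exI[of _ 1])
  then have "\<forall>\<^sub>F s in at_right 0. frac_laplacian w s u x
      = u x - (\<Sum>y | u y \<noteq> 0. u y * (\<Sum>k. sibuya s k * walk k y x))"
    by eventually_elim (auto intro: frac_laplacian_eq assms)
  ultimately show ?thesis
    by (subst tendsto_cong) auto
qed

end

theorem proposition1p7:
  fixes w :: "int ^ 'd \<Rightarrow> int ^ 'd \<Rightarrow> real"
    and u :: "int ^ 'd \<Rightarrow> real"
    and x :: "int ^ 'd"
  assumes "lattice_weight w"
    and "0 < mu_min w" and "mu_min w \<le> mu_max w" and "mu_max w < \<infinity>"
    and "0 < w_min w"
    and "finite {y. u y \<noteq> 0}"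
  shows "((\<lambda>s. frac_laplacian w s u x) \<longlongrightarrow> u x) (at_right 0)"
proof -
  obtain m where m: "0 < ereal m" "ereal m < mu_min w"
    using ereal_dense2[OF \<open>0 < mu_min w\<close>] by auto
  have "m \<le> vertex_measure w z" for z
    using less_INF_D[OF m(2)[unfolded mu_min_def], of z] by simp
  then interpret weighted_lattice w m
    using assms(1) m(1) by unfold_locales auto
  show ?thesis by (rule frac_laplacian_tendsto[OF assms(6)])
qed

end
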